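(* Let $\theta\in(0,\pi)$. Among all triangles with area $1$ and having an interior angle equal to $\theta$, the isosceles triangle of area $1$ with interior angle $\theta$ opposite the base maximizes both $\rho_1$ and $\rho_2$.
   Context: For a bounded simply connected region $\Omega\subseteq\mathbb{C}$ whose boundary is a Jordan curve and $N\in\mathbb{N}$, let $\mathcal{P}_N$ be the space of complex polynomials in $z$ of degree at most $N$, and let $dA$ denote area measure. Define $$\rho_N(\Omega):=\min_{p\in\mathcal{P}_N}\int_\Omega|\bar z-p(z)|^2\,dA(z),$$ the square of the distance from $\bar z$ to $\mathcal{P}_N$ in $L^2(\Omega,dA)$. Triangles are regarded as regions in $\mathbb{C}\cong\mathbb{R}^2$; $\rho_N$ is invariant under congruence. The base of an isosceles triangle is the side whose two adjacent sides have equal length; in an equilateral triangle any side may be considered as the base. A triangle maximizes $\rho_N$ in a class if it belongs to the class and its $\rho_N$ value is at least that of every other triangle in the class. *)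

theory Defs
  imports "HOL-Analysis.Analysis" "HOL-Computational_Algebra.Polynomial"
begin

(* The infimum is a minimum whenever \<Omega> is a bounded open nonempty set, being the squared
   L2-distance of the conjugation map to a finite-dimensional subspace. *)
definition rho :: "nat \<Rightarrow> complex set \<Rightarrow> real" where
  "rho N \<Omega> = (INF p \<in> {p :: complex poly. degree p \<le> N}.
                 (LINT z:\<Omega>|lborel. (norm (cnj z - poly p z))\<^sup>2))"

(* Regions are open, hence the interior of the convex hull of the vertices. *)
definition triangle_region :: "complex \<Rightarrow> complex \<Rightarrow> complex \<Rightarrow> complex set" where
  "triangle_region a b c = interior (convex hull {a, b, c})"

(* The unoriented angle at a, between the rays towards b and c. *)
definition angle_at :: "complex \<Rightarrow> complex \<Rightarrow> complex \<Rightarrow> real" where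
  "angle_at a b c = arccos (((b - a) \<bullet> (c - a)) / (norm (b - a) * norm (c - a)))"

(* Triangles are plain sets, so the vertices may be labelled with the angle \<theta> at the first one. *)
definition angle_triangles :: "real \<Rightarrow> complex set set" where
  "angle_triangles \<theta> = {T. \<exists>a b c. \<not> collinear {a, b, c} \<and> T = triangle_region a b c \<and>
     measure lborel T = 1 \<and> angle_at a b c = \<theta>}"

(* The side from b to c is the base. *)
definition isosceles_angle_triangles :: "real \<Rightarrow> complex set set" where
  "isosceles_angle_triangles \<theta> = {T. \<exists>a b c. \<not> collinear {a, b, c} \<and> T = triangle_region a b c \<and>
     measure lborel T = 1 \<and> angle_at a b c = \<theta> \<and> dist a b = dist a c}"

end

theory Submission
  imports Defs
begin

text \<open>
  In coordinates centred at the centroid, the best approximation of the conjugate by quadratic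
  polynomials only involves the moments of the triangle up to order four. Writing \<open>A\<close> for the area,
  \<open>Q\<close> for the sum and \<open>\<Xi>\<close> for the product of the squared side lengths, completing squares gives
  \<open>\<rho>\<^sub>1 = (4/3) A^3 / Q\<close> and \<open>\<rho>\<^sub>2 = (4/3) A^3 / (Q + 48 \<Xi> / (3 Q^2 - 16 A^2))\<close>.
  Fixing \<open>A\<close> and the angle \<open>\<theta>\<close> fixes both the product and the inner product of the two sides
  enclosing \<open>\<theta>\<close>. Hence \<open>Q\<close> is minimal exactly when these sides have equal length, \<open>\<Xi>\<close> is an affine
  function of \<open>Q\<close>, and both denominators are increasing in \<open>Q\<close>.
\<close>

section \<open>Affine coordinates for Lebesgue measure on the complex plane\<close>

text \<open>Lebesgue measure is characterised by its values on boxes, and \<open>Complex\<close>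
  identifies boxes with products of intervals. This makes Tonelli's theorem available on the complex
  plane.\<close>

lemma lborel_complex_eq: "(lborel :: complex measure) = distr lborel borel (\<lambda>(x,y). Complex x y)"
proof (rule lborel_eqI)
  fix l u :: complex assume lu: "\<And>b. b \<in> Basis \<Longrightarrow> l \<bullet> b \<le> u \<bullet> b"
  have [measurable]: "(\<lambda>(x,y). Complex x y) \<in> borel \<rightarrow>\<^sub>M borel"
    unfolding case_prod_beta by (intro borel_measurable_continuous_onI continuous_intros)
  have "(\<lambda>(x,y). Complex x y) -` box l u = box (Re l, Im l) (Re u, Im u)"
    by (auto simp: box_def Basis_complex_def Basis_prod_def inner_Pair_0)
  moreover have "emeasure lborel (box (Re l, Im l) (Re u, Im u)) = ennreal ((Re u - Re l) * (Im u - Im l))"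
    using lu[of 1] lu[of \<i>]
    by (subst emeasure_lborel_box) (auto simp: Basis_prod_def Basis_complex_def inner_Pair_0)
  ultimately show "emeasure (distr lborel borel (\<lambda>(x,y). Complex x y)) (box l u) = ennreal (\<Prod>b\<in>Basis. (u - l) \<bullet> b)"
    by (subst emeasure_distr) (auto simp: Basis_complex_def complex_i_not_one[symmetric])
qed simp

lemma nn_integral_lborel_complex:
  assumes [measurable]: "f \<in> borel_measurable borel"
  shows "(\<integral>\<^sup>+z. f z \<partial>lborel) = (\<integral>\<^sup>+x. \<integral>\<^sup>+y. f (Complex x y) \<partial>lborel \<partial>lborel)"
proof -
  have [measurable]: "(\<lambda>(x,y). Complex x y) \<in> borel \<rightarrow>\<^sub>M borel"
    unfolding case_prod_beta by (intro borel_measurable_continuous_onI continuous_intros)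
  have m: "(\<lambda>p. f (case p of (x,y) \<Rightarrow> Complex x y)) \<in> borel_measurable (lborel \<Otimes>\<^sub>M lborel)"
    unfolding lborel_prod by measurable
  have "(\<integral>\<^sup>+z. f z \<partial>lborel) = (\<integral>\<^sup>+p. f (case p of (x,y) \<Rightarrow> Complex x y) \<partial>(lborel \<Otimes>\<^sub>M lborel))"
    by (subst lborel_complex_eq) (simp add: nn_integral_distr lborel_prod)
  also have "\<dots> = (\<integral>\<^sup>+x. \<integral>\<^sup>+y. f (Complex x y) \<partial>lborel \<partial>lborel)"
    by (subst lborel.nn_integral_fst[OF m, symmetric]) simp
  finally show ?thesis .
qed

text \<open>A triangular factorisation of the matrix with columns (a1, a2) and (b1, b2): once
  \<open>a1\<close> serves as a pivot, two one-dimensional substitutions suffice, and the product of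
  their slopes is the determinant.\<close>

lemma nn_integral_lborel_complex_affine_Re_nonzero:
  fixes f :: "complex \<Rightarrow> ennreal" and p q a1 a2 b1 b2 :: real
  assumes [measurable]: "f \<in> borel_measurable borel" and "a1 \<noteq> 0" and d: "a1 * b2 - a2 * b1 \<noteq> 0"
  shows "(\<integral>\<^sup>+z. f z \<partial>lborel) = ennreal \<bar>a1 * b2 - a2 * b1\<bar> *
           (\<integral>\<^sup>+y. \<integral>\<^sup>+x. f (Complex (p + a1 * x + b1 * y) (q + a2 * x + b2 * y)) \<partial>lborel \<partial>lborel)"
proof -
  \<comment> \<open>The second pivot. For fixed \<open>x\<close> the inner variable is replaced by
    an affine function of slope \<open>e\<close> whose offset depends on \<open>x\<close>; this
    offset is chosen so that the later substitution for \<open>x\<close> yields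
    \<open>q + a2 * x + b2 * y\<close>.\<close>
  define e where "e = (a1 * b2 - a2 * b1) / a1"
  have e: "e \<noteq> 0" using assms by (simp add: e_def)
  have C[measurable]: "(\<lambda>p. Complex (g p) (h p)) \<in> borel_measurable M"
    if [measurable]: "g \<in> borel_measurable M" "h \<in> borel_measurable M" for g h and M :: "'a measure"
    by (simp add: borel_measurable_complex_iff)
  have "(\<integral>\<^sup>+z. f z \<partial>lborel) = (\<integral>\<^sup>+x. \<integral>\<^sup>+y. f (Complex x y) \<partial>lborel \<partial>lborel)"
    by (rule nn_integral_lborel_complex) fact
  also have "\<dots> = (\<integral>\<^sup>+x. ennreal \<bar>e\<bar> * \<integral>\<^sup>+y. f (Complex x ((q + a2 * (x - p) / a1) + e * y)) \<partial>lborel \<partial>lborel)"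
    by (intro nn_integral_cong nn_integral_real_affine e) measurable
  also have "\<dots> = ennreal \<bar>e\<bar> * (\<integral>\<^sup>+x. \<integral>\<^sup>+y. f (Complex x ((q + a2 * (x - p) / a1) + e * y)) \<partial>lborel \<partial>lborel)"
    by (rule nn_integral_cmult) measurable
  also have "(\<integral>\<^sup>+x. \<integral>\<^sup>+y. f (Complex x ((q + a2 * (x - p) / a1) + e * y)) \<partial>lborel \<partial>lborel)
     = (\<integral>\<^sup>+y. \<integral>\<^sup>+x. f (Complex x ((q + a2 * (x - p) / a1) + e * y)) \<partial>lborel \<partial>lborel)"
    by (rule lborel_pair.Fubini') measurable
  also have "\<dots> = (\<integral>\<^sup>+y. ennreal \<bar>a1\<bar> * \<integral>\<^sup>+x. f (Complex ((p + b1 * y) + a1 * x)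
       ((q + a2 * (((p + b1 * y) + a1 * x) - p) / a1) + e * y)) \<partial>lborel \<partial>lborel)"
    by (intro nn_integral_cong nn_integral_real_affine) (use assms in measurable)
  also have "\<dots> = ennreal \<bar>a1\<bar> * (\<integral>\<^sup>+y. \<integral>\<^sup>+x. f (Complex ((p + b1 * y) + a1 * x)
       ((q + a2 * (((p + b1 * y) + a1 * x) - p) / a1) + e * y)) \<partial>lborel \<partial>lborel)"
    by (rule nn_integral_cmult) measurable
  finally have "(\<integral>\<^sup>+z. f z \<partial>lborel) = ennreal \<bar>e\<bar> * (ennreal \<bar>a1\<bar> *
        (\<integral>\<^sup>+y. \<integral>\<^sup>+x. f (Complex ((p + b1 * y) + a1 * x) ((q + a2 * (((p + b1 * y) + a1 * x) - p) / a1) + e * y)) \<partial>lborel \<partial>lborel))" .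
  moreover have "((p + b1 * y) + a1 * x) = (p + a1 * x + b1 * y)"
     "((q + a2 * (((p + b1 * y) + a1 * x) - p) / a1) + e * y) = (q + a2 * x + b2 * y)" for x y
    using \<open>a1 \<noteq> 0\<close> by (auto simp: e_def field_simps)
  moreover have "ennreal \<bar>e\<bar> * (ennreal \<bar>a1\<bar> * X) = ennreal \<bar>a1 * b2 - a2 * b1\<bar> * X" for X
  proof -
    have "e * a1 = a1 * b2 - a2 * b1"
      using \<open>a1 \<noteq> 0\<close> by (simp add: e_def)
    then have "\<bar>e\<bar> * \<bar>a1\<bar> = \<bar>a1 * b2 - a2 * b1\<bar>"
      by (metis abs_mult)
    then show ?thesis by (metis abs_ge_zero ennreal_mult mult.assoc)
  qed
  ultimately show ?thesis by (simp only:)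
qed

text \<open>\<open>Im (cnj u * v)\<close> is the determinant of the real matrix with columns
  \<open>u\<close> and \<open>v\<close>. If \<open>Re u = 0\<close>, it can only be nonzero when
  \<open>Re v\<close> is, so \<open>u\<close> and \<open>v\<close> exchange roles.\<close>

lemma nn_integral_lborel_complex_affine:
  fixes f :: "complex \<Rightarrow> ennreal" and g u v :: complex
  assumes f[measurable]: "f \<in> borel_measurable borel" and d: "Im (cnj u * v) \<noteq> 0"
  shows "(\<integral>\<^sup>+z. f z \<partial>lborel) = ennreal \<bar>Im (cnj u * v)\<bar> *
           (\<integral>\<^sup>+(x, y). f (g + of_real x * u + of_real y * v) \<partial>lborel)"
proof -
  have eq: "g + of_real x * u + of_real y * v =
    Complex (Re g + Re u * x + Re v * y) (Im g + Im u * x + Im v * y)" for x y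
    by (simp add: complex_eq_iff)
  have d': "Re u * Im v - Im u * Re v \<noteq> 0" "\<bar>Im (cnj u * v)\<bar> = \<bar>Re u * Im v - Im u * Re v\<bar>"
    using d by (auto simp: algebra_simps)
  have m: "(\<lambda>(x, y). f (g + of_real x * u + of_real y * v)) \<in> borel_measurable (lborel \<Otimes>\<^sub>M lborel)"
    by measurable
  have F: "(\<integral>\<^sup>+(x, y). f (g + of_real x * u + of_real y * v) \<partial>lborel) =
    (\<integral>\<^sup>+y. \<integral>\<^sup>+x. f (g + of_real x * u + of_real y * v) \<partial>lborel \<partial>lborel)"
    "(\<integral>\<^sup>+(x, y). f (g + of_real x * u + of_real y * v) \<partial>lborel) =
    (\<integral>\<^sup>+x. \<integral>\<^sup>+y. f (g + of_real x * u + of_real y * v) \<partial>lborel \<partial>lborel)"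
    using lborel_pair.nn_integral_snd[OF m] lborel.nn_integral_fst[OF m]
    by (simp_all add: lborel_prod)
  show ?thesis
  proof (cases "Re u = 0")
    case False
    then show ?thesis unfolding F(1) d'(2) unfolding eq
      by (intro nn_integral_lborel_complex_affine_Re_nonzero) (use d' in auto)
  next
    case True
    then have "Re v \<noteq> 0" using d' by auto
    then have "(\<integral>\<^sup>+z. f z \<partial>lborel) = ennreal \<bar>Re v * Im u - Im v * Re u\<bar> *
      (\<integral>\<^sup>+x. \<integral>\<^sup>+y. f (Complex (Re g + Re v * y + Re u * x) (Im g + Im v * y + Im u * x)) \<partial>lborel \<partial>lborel)"
      by (intro nn_integral_lborel_complex_affine_Re_nonzero) (use d' in \<open>auto simp: algebra_simps\<close>)
    moreover have "\<bar>Re v * Im u - Im v * Re u\<bar> = \<bar>Re u * Im v - Im u * Re v\<bar>"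
      by (simp add: abs_minus_commute algebra_simps)
    ultimately show ?thesis unfolding F(2) d'(2) unfolding eq by (simp add: algebra_simps)
  qed
qed

text \<open>As an equality of measures, the change of variables also applies to Bochner
  integrals.\<close>

lemma lborel_complex_affine:
  fixes g u v :: complex
  assumes d: "Im (cnj u * v) \<noteq> 0"
  shows "lborel = density (distr lborel borel (\<lambda>(x, y). g + of_real x * u + of_real y * v))
     (\<lambda>_. ennreal \<bar>Im (cnj u * v)\<bar>)"
proof (rule measure_eqI)
  have [measurable]: "(\<lambda>(x, y). g + of_real x * u + of_real y * v) \<in> borel \<rightarrow>\<^sub>M borel"
    "(\<lambda>p. g + of_real (fst p) * u + of_real (snd p) * v) \<in> borel \<rightarrow>\<^sub>M borel"
    unfolding case_prod_beta by (intro borel_measurable_continuous_onI continuous_intros)+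
  fix A :: "complex set" assume "A \<in> sets lborel"
  then have [measurable]: "A \<in> sets borel" by simp
  have "emeasure lborel A = (\<integral>\<^sup>+z. indicator A z \<partial>lborel)" by simp
  also have "\<dots> = ennreal \<bar>Im (cnj u * v)\<bar> *
           (\<integral>\<^sup>+(x, y). indicator A (g + of_real x * u + of_real y * v) \<partial>lborel)"
    by (rule nn_integral_lborel_complex_affine) (use d in auto)
  also have "(\<integral>\<^sup>+(x, y). indicator A (g + of_real x * u + of_real y * v) \<partial>lborel)
      = (\<integral>\<^sup>+z. indicator A z \<partial>distr lborel borel (\<lambda>(x, y). g + of_real x * u + of_real y * v))"
    by (subst nn_integral_distr) (auto simp: case_prod_beta')
  finally show "emeasure lborel A = emeasure (density (distr lborel borel (\<lambda>(x, y). g + of_real x * u + of_real y * v))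
     (\<lambda>_. ennreal \<bar>Im (cnj u * v)\<bar>)) A"
    by (simp add: emeasure_density nn_integral_cmult)
qed simp

section \<open>Moments of triangles\<close>

text \<open>Open, like \<open>triangle_region\<close>, so that the affine parametrisation matches
  the two sets exactly and no boundary has to be discarded.\<close>

definition unit_triangle :: "(real \<times> real) set" where
  "unit_triangle = {(x, y). 0 < x \<and> 0 < y \<and> x + y < 1}"

lemma unit_triangle_borel [measurable]: "unit_triangle \<in> sets borel"
proof -
  have "unit_triangle = {p. 0 < fst p} \<inter> {p. 0 < snd p} \<inter> {p. fst p + snd p < 1}"
    by (auto simp: unit_triangle_def)
  moreover have "open \<dots>"
    by (intro open_Int open_Collect_less continuous_intros)
  ultimately show ?thesis by simp
qed

section \<open>Integrals of monomials over the unit triangle\<close>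

lemma nn_integral_power_Ioo:
  fixes t :: real assumes "0 \<le> t"
  shows "(\<integral>\<^sup>+y. ennreal (y ^ j) * indicator {0<..<t} y \<partial>lborel) = ennreal (t ^ Suc j / Suc j)"
proof -
  have "(\<integral>\<^sup>+y. ennreal (y ^ j) * indicator {0<..<t} y \<partial>lborel) = (\<integral>\<^sup>+y. ennreal (y ^ j) * indicator {0..t} y \<partial>lborel)"
    by (intro nn_integral_cong_AE)
      (use AE_lborel_singleton[of 0] AE_lborel_singleton[of t] in \<open>eventually_elim, auto simp: indicator_def\<close>)
  also have "\<dots> = ennreal (t ^ Suc j / Suc j - 0 ^ Suc j / Suc j)"
    by (rule nn_integral_FTC_Icc) (use assms in \<open>auto intro!: derivative_eq_intros simp del: power_Suc\<close>)
  finally show ?thesis by simp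
qed

text \<open>Euler's Beta integral at integer arguments. The open interval is essential to the
  conversion, as \<open>powr\<close> is turned into an ordinary power for positive bases.\<close>

lemma has_integral_Beta_nat:
  "((\<lambda>t::real. t ^ i * (1 - t) ^ j) has_integral (fact i * fact j / fact (i + j + 1))) {0<..<1}"
proof -
  have "((\<lambda>t. t powr (real (i + 1) - 1) * (1 - t) powr (real (j + 1) - 1)) has_integral
      Beta (real (i + 1)) (real (j + 1))) {0<..<1}"
    using has_integral_Beta_real[of "real (i+1)" "real (j+1)"] unfolding has_integral_Icc_iff_Ioo by simp
  moreover have "Beta (real (i + 1)) (real (j + 1)) = fact i * fact j / fact (i + j + 1)"
    using Gamma_fact[of i, where 'a = real] Gamma_fact[of j, where 'a = real] Gamma_fact[of "i + j + 1", where 'a = real]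
    by (simp add: Beta_def add_ac)
  ultimately show ?thesis
    by (auto simp: powr_realpow intro: has_integral_eq[rotated])
qed

text \<open>A Dirichlet integral: integrating out \<open>y\<close> over (0, 1 - x) leaves a Beta
  integral in \<open>x\<close>. Nonnegative integrals allow Tonelli without a prior integrability
  proof.\<close>

lemma nn_integral_unit_triangle_monomial:
  "(\<integral>\<^sup>+p. ennreal (fst p ^ i * snd p ^ j) * indicator unit_triangle p \<partial>lborel)
     = ennreal (fact i * fact j / fact (i + j + 2))" (is "?L = _")
proof -
  have [measurable]: "(\<lambda>p::real \<times> real. fst p ^ i * snd p ^ j) \<in> borel_measurable borel"
    by (intro borel_measurable_continuous_onI continuous_intros)
  have "?L = (\<integral>\<^sup>+p. ennreal (fst p ^ i * snd p ^ j) * indicator unit_triangle p \<partial>(lborel \<Otimes>\<^sub>M lborel))"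
    by (simp add: lborel_prod)
  also have "\<dots> = (\<integral>\<^sup>+x. \<integral>\<^sup>+y. ennreal (x ^ i * y ^ j) * indicator unit_triangle (x, y) \<partial>lborel \<partial>lborel)"
    by (subst lborel.nn_integral_fst[symmetric]) (simp_all add: lborel_prod)
  also have "\<dots> = (\<integral>\<^sup>+x. ennreal (x ^ i * (1 - x) ^ Suc j / Suc j) * indicator {0<..<1} x \<partial>lborel)"
  proof (intro nn_integral_cong)
    fix x :: real
    show "(\<integral>\<^sup>+y. ennreal (x ^ i * y ^ j) * indicator unit_triangle (x, y) \<partial>lborel)
       = ennreal (x ^ i * (1 - x) ^ Suc j / Suc j) * indicator {0<..<1} x"
    proof (cases "x \<in> {0<..<1}")
      case True
      then have "(\<integral>\<^sup>+y. ennreal (x ^ i * y ^ j) * indicator unit_triangle (x, y) \<partial>lborel)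
        = (\<integral>\<^sup>+y. ennreal (x ^ i) * (ennreal (y ^ j) * indicator {0<..<1 - x} y) \<partial>lborel)"
        by (intro nn_integral_cong) (auto simp: unit_triangle_def indicator_def ennreal_mult)
      also have "\<dots> = ennreal (x ^ i) * ennreal ((1 - x) ^ Suc j / Suc j)"
        using True by (subst nn_integral_cmult) (simp_all add: nn_integral_power_Ioo del: power_Suc)
      finally show ?thesis using True by (simp add: ennreal_mult[symmetric])
    next
      case False
      then have "indicator unit_triangle (x, y) = (0::ennreal)" for y
        by (auto simp: unit_triangle_def indicator_def)
      then show ?thesis using False by simp
    qed
  qed
  also have "\<dots> = (\<integral>\<^sup>+x. ennreal (if x \<in> {0<..<1} then x ^ i * (1 - x) ^ Suc j / Suc j else 0) \<partial>lborel)"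
    by (intro nn_integral_cong) auto
  also have "\<dots> = ennreal (fact i * fact (Suc j) / fact (i + Suc j + 1) / Suc j)"
    by (intro nn_integral_has_integral_lborel
          has_integral_restrict_UNIV[THEN iffD2, OF has_integral_divide[OF has_integral_Beta_nat]])
       (simp_all del: power_Suc)
  also have "fact i * fact (Suc j) / fact (i + Suc j + 1) / Suc j = (fact i * fact j / fact (i + j + 2) :: real)"
  proof -
    have "i + Suc j + 1 = i + j + 2" "fact (Suc j) = real (Suc j) * fact j"
      by simp_all
    then show ?thesis by (simp del: fact_Suc of_nat_Suc)
  qed
  finally show ?thesis .
qed

lemma has_bochner_integral_unit_triangle_monomial:
  "has_bochner_integral (restrict_space lborel unit_triangle)
     (\<lambda>(x, y). complex_of_real x ^ i * complex_of_real y ^ j) (of_real (fact i * fact j / fact (i + j + 2)))"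
proof -
  have [measurable]: "(\<lambda>p::real \<times> real. fst p ^ i * snd p ^ j) \<in> borel_measurable borel"
    by (intro borel_measurable_continuous_onI continuous_intros)
  have "has_bochner_integral lborel (\<lambda>p. indicator unit_triangle p * (fst p ^ i * snd p ^ j))
    (fact i * fact j / fact (i + j + 2) :: real)"
  proof (rule has_bochner_integral_nn_integral)
    have "(\<integral>\<^sup>+p. ennreal (indicator unit_triangle p * (fst p ^ i * snd p ^ j)) \<partial>lborel)
       = (\<integral>\<^sup>+p. ennreal (fst p ^ i * snd p ^ j) * indicator unit_triangle p \<partial>lborel)"
      by (intro nn_integral_cong) (auto simp: indicator_def)
    then show "(\<integral>\<^sup>+p. ennreal (indicator unit_triangle p * (fst p ^ i * snd p ^ j)) \<partial>lborel)
        = ennreal (fact i * fact j / fact (i + j + 2))"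
      using nn_integral_unit_triangle_monomial by metis
    show "(\<lambda>p. indicator unit_triangle p * (fst p ^ i * snd p ^ j)) \<in> borel_measurable lborel"
      by measurable
  qed (auto simp: unit_triangle_def indicator_def)
  then have "has_bochner_integral (restrict_space lborel unit_triangle) (\<lambda>p. fst p ^ i * snd p ^ j)
    (fact i * fact j / fact (i + j + 2) :: real)"
    by (subst has_bochner_integral_restrict_space) simp_all
  from has_bochner_integral_of_real[OF this, where 'a = complex] show ?thesis
    by (simp add: case_prod_beta')
qed

section \<open>Parametrisation of a triangle by the unit triangle\<close>

lemma Im_cnj_mult_nonzero_if_not_collinear:
  assumes "\<not> collinear {a, b, c :: complex}"
  shows "Im (cnj (b - a) * (c - a)) \<noteq> 0"
proof
  assume *: "Im (cnj (b - a) * (c - a)) = 0"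
  \<comment> \<open>A vanishing determinant makes the quotient of the edge vectors real, which is
    collinearity.\<close>
  have "Im ((c - a) / (b - a)) = Im (cnj (b - a) * (c - a)) / (norm (b - a))\<^sup>2"
    by (simp add: complex_div_cnj[of "c - a" "b - a"] mult.commute)
  then have "(c - a) / (b - a) \<in> \<real>"
    using * by (simp add: complex_is_Real_iff)
  then have "collinear {b, a, c}"
    by (simp add: collinear_3[of b] collinear_iff_Reals)
  with assms show False by (simp add: insert_commute)
qed

lemma real_linear_combination_eq_0:
  assumes "of_real s * u + of_real t * v = 0" and d: "Im (cnj u * v) \<noteq> 0"
  shows "s = 0 \<and> t = 0"
proof -
  have "s * Re u + t * Re v = 0" "s * Im u + t * Im v = 0"
    using arg_cong[OF assms(1), of Re] arg_cong[OF assms(1), of Im] by simp_all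
  \<comment> \<open>Cramer's rule: eliminate one unknown from the real and imaginary parts.\<close>
  then have "s * Im (cnj u * v) = 0" "t * Im (cnj u * v) = 0"
    by (simp, algebra)+
  with d show ?thesis by auto
qed

text \<open>Here \<open>1 - x - y\<close>, \<open>x\<close> and \<open>y\<close> are the barycentric
  coordinates for \<open>a\<close>, \<open>b\<close> and \<open>c\<close>. They are unique because
  the edge vectors are linearly independent over the reals, and interior points are those with all
  three positive.\<close>

lemma mem_triangle_region_iff:
  assumes "\<not> collinear {a, b, c :: complex}"
  shows "a + of_real x * (b - a) + of_real y * (c - a) \<in> triangle_region a b c \<longleftrightarrow> (x, y) \<in> unit_triangle"
proof
  note d = Im_cnj_mult_nonzero_if_not_collinear[OF assms]
  assume "a + of_real x * (b - a) + of_real y * (c - a) \<in> triangle_region a b c"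
  then obtain r s t where rst: "0 < r" "0 < s" "0 < t" "r + s + t = 1"
    "r *\<^sub>R a + s *\<^sub>R b + t *\<^sub>R c = a + of_real x * (b - a) + of_real y * (c - a)"
    using assms by (auto simp: triangle_region_def interior_convex_hull_3_minimal)
  have r: "r = 1 - s - t" using rst by simp
  have "of_real (s - x) * (b - a) + of_real (t - y) * (c - a) = 0"
    using rst(5) unfolding r by (simp add: scaleR_conv_of_real algebra_simps)
  from real_linear_combination_eq_0[OF this d] have "s - x = 0" "t - y = 0" by auto
  then show "(x, y) \<in> unit_triangle" using rst by (auto simp: unit_triangle_def)
next
  assume "(x, y) \<in> unit_triangle"
  then have "0 < 1 - x - y" "0 < x" "0 < y" by (auto simp: unit_triangle_def)
  moreover have "(1 - x - y) *\<^sub>R a + x *\<^sub>R b + y *\<^sub>R c = a + of_real x * (b - a) + of_real y * (c - a)"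
    by (simp add: scaleR_conv_of_real algebra_simps)
  moreover have "(1 - x - y) + x + y = 1" by simp
  ultimately show "a + of_real x * (b - a) + of_real y * (c - a) \<in> triangle_region a b c"
    unfolding triangle_region_def interior_convex_hull_3_minimal[OF assms DIM_complex] by blast
qed

lemma set_integral_triangle_region:
  fixes f :: "complex \<Rightarrow> real"
  assumes nc: "\<not> collinear {a, b, c}" and [measurable]: "f \<in> borel_measurable borel"
  shows "(LINT z:triangle_region a b c|lborel. f z) = \<bar>Im (cnj (b - a) * (c - a))\<bar> *
     (LINT (x, y)|restrict_space lborel unit_triangle. f (a + of_real x * (b - a) + of_real y * (c - a)))"
proof -
  define T where "T = triangle_region a b c"
  have [measurable]: "T \<in> sets borel" unfolding T_def triangle_region_def by simp
  have [measurable]: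
    "(\<lambda>p. a + of_real (fst p) * (b - a) + of_real (snd p) * (c - a)) \<in> borel \<rightarrow>\<^sub>M borel"
    by (intro borel_measurable_continuous_onI continuous_intros)+
  have "(LINT z:T|lborel. f z) = \<bar>Im (cnj (b - a) * (c - a))\<bar> *
     (LINT p|lborel. indicator T (a + of_real (fst p) * (b - a) + of_real (snd p) * (c - a)) *
        f (a + of_real (fst p) * (b - a) + of_real (snd p) * (c - a)))"
    unfolding set_lebesgue_integral_def
    by (subst lborel_complex_affine[OF Im_cnj_mult_nonzero_if_not_collinear[OF nc], of a])
      (simp add: integral_density integral_distr case_prod_beta' del: minus_complex.sel times_complex.sel)
  also have "\<dots> = \<bar>Im (cnj (b - a) * (c - a))\<bar> *
     (LINT p|lborel. indicator unit_triangle p * f (a + of_real (fst p) * (b - a) + of_real (snd p) * (c - a)))"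
    by (simp add: T_def indicator_def mem_triangle_region_iff[OF nc] del: minus_complex.sel times_complex.sel)
  finally show ?thesis
    by (simp add: T_def integral_restrict_space case_prod_beta' del: minus_complex.sel times_complex.sel)
qed

lemma measure_triangle_region:
  assumes nc: "\<not> collinear {a, b, c :: complex}"
  shows "measure lborel (triangle_region a b c) = \<bar>Im (cnj (b - a) * (c - a))\<bar> / 2"
proof -
  have "bounded (triangle_region a b c)"
    unfolding triangle_region_def by (intro bounded_interior finite_imp_bounded_convex_hull) simp
  then have "emeasure lborel (triangle_region a b c) < \<infinity>" by (rule emeasure_bounded_finite)
  then have "measure lborel (triangle_region a b c) = (LINT z:triangle_region a b c|lborel. 1)"
    by (simp add: set_lebesgue_integral_def)
  also have "\<dots> = \<bar>Im (cnj (b - a) * (c - a))\<bar> * measure lborel unit_triangle"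
    by (subst set_integral_triangle_region[OF nc]) (simp_all add: case_prod_beta' measure_restrict_space)
  also have "measure lborel unit_triangle = 1 / 2"
  proof -
    have "emeasure lborel unit_triangle = ennreal (1 / 2)"
      using nn_integral_unit_triangle_monomial[of 0 0] by simp
    then show ?thesis by (simp only: measure_def enn2real_ennreal)
  qed
  finally show ?thesis by simp
qed

section \<open>Moments up to order four about the centroid\<close>

lemma has_bochner_integral_unit_triangle_quadratics:
  "has_bochner_integral (restrict_space lborel unit_triangle)
     (\<lambda>(x, y). (p0 + p1 * of_real x + p2 * of_real y + p3 * of_real x ^ 2 + p4 * of_real x * of_real y + p5 * of_real y ^ 2) *
               (q0 + q1 * of_real x + q2 * of_real y + q3 * of_real x ^ 2 + q4 * of_real x * of_real y + q5 * of_real y ^ 2))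
     (p0 * q0 / 2 + (p0 * q1 + p1 * q0) / 6 + (p0 * q2 + p2 * q0) / 6
      + (p0 * q3 + p1 * q1 + p3 * q0) / 12 + (p0 * q4 + p1 * q2 + p2 * q1 + p4 * q0) / 24
      + (p0 * q5 + p2 * q2 + p5 * q0) / 12
      + (p1 * q3 + p3 * q1) / 20 + (p1 * q4 + p4 * q1 + p2 * q3 + p3 * q2) / 60
      + (p1 * q5 + p5 * q1 + p2 * q4 + p4 * q2) / 60 + (p2 * q5 + p5 * q2) / 20
      + p3 * q3 / 30 + (p3 * q4 + p4 * q3) / 120 + (p3 * q5 + p5 * q3 + p4 * q4) / 180
      + (p4 * q5 + p5 * q4) / 120 + p5 * q5 / 30 :: complex)"
proof -
  \<comment> \<open>The product of the two quadratics is collected by monomials; each denominator in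
    the result is (i + j + 2)! / (i! j!). All later moments specialise the twelve
    coefficients.\<close>
  define M where "M i j = (\<lambda>p. complex_of_real (fst p) ^ i * complex_of_real (snd p) ^ j)" for i j
  have M: "has_bochner_integral (restrict_space lborel unit_triangle) (\<lambda>p. k * M i j p)
      (k * of_real (fact i * fact j / fact (i + j + 2)))" for i j k
    using has_bochner_integral_mult_right[OF has_bochner_integral_unit_triangle_monomial]
    by (simp add: M_def case_prod_beta')
  note add = has_bochner_integral_add
  note I = add[OF M[of "p0*q0" 0 0] add[OF M[of "p0*q1+p1*q0" 1 0] add[OF M[of "p0*q2+p2*q0" 0 1]
     add[OF M[of "p0 * q3 + p1 * q1 + p3 * q0" 2 0] add[OF M[of "p0 * q4 + p1 * q2 + p2 * q1 + p4 * q0" 1 1]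
     add[OF M[of "p0 * q5 + p2 * q2 + p5 * q0" 0 2] add[OF M[of "p1 * q3 + p3 * q1" 3 0]
     add[OF M[of "p1 * q4 + p4 * q1 + p2 * q3 + p3 * q2" 2 1] add[OF M[of "p1 * q5 + p5 * q1 + p2 * q4 + p4 * q2" 1 2]
     add[OF M[of "p2 * q5 + p5 * q2" 0 3] add[OF M[of "p3 * q3" 4 0] add[OF M[of "p3 * q4 + p4 * q3" 3 1]
     add[OF M[of "p3 * q5 + p5 * q3 + p4 * q4" 2 2] add[OF M[of "p4 * q5 + p5 * q4" 1 3] M[of "p5 * q5" 0 4]
     ]]]]]]]]]]]]]]
  show ?thesis
    by (rule has_bochner_integral_cong[THEN iffD1, OF refl _ _ I])
       (simp_all add: M_def case_prod_beta' fact_numeral add_divide_distrib algebra_simps power2_eq_square power3_eq_cube power4_eq_xxxx)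
qed

text \<open>The point with parameters \<open>p\<close>, measured from the centroid. Replacing
  \<open>u\<close> and \<open>v\<close> by their conjugates conjugates the value.\<close>

definition centred :: "complex \<Rightarrow> complex \<Rightarrow> real \<times> real \<Rightarrow> complex" where
  "centred u v p = of_real (fst p) * u + of_real (snd p) * v - (u + v) / 3"

lemma has_bochner_integral_centred1:
  "has_bochner_integral (restrict_space lborel unit_triangle) (centred u v) 0"
  by (rule has_bochner_integral_cong[THEN iffD1, OF refl _ _
        has_bochner_integral_unit_triangle_quadratics[of "- (u + v) / 3" u v 0 0 0 1 0 0 0 0 0]])
     (auto simp: centred_def field_simps)

text \<open>The primed vectors are independent of \<open>u\<close> and \<open>v\<close>, so one
  statement yields both the mean of z^2 and, with conjugates inserted, that of |z|^2. Since the unit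
  triangle has area 1/2, these integrals are half the means.\<close>

lemma has_bochner_integral_centred2:
  "has_bochner_integral (restrict_space lborel unit_triangle) (\<lambda>p. centred u v p * centred u' v' p)
     ((2 * u * u' + 2 * v * v' - u * v' - v * u') / 72)"
  by (rule has_bochner_integral_cong[THEN iffD1, OF refl _ _
        has_bochner_integral_unit_triangle_quadratics[of "- (u + v) / 3" u v 0 0 0 "- (u' + v') / 3" u' v' 0 0 0]])
     (auto simp: centred_def field_simps)

lemma has_bochner_integral_centred3:
  "has_bochner_integral (restrict_space lborel unit_triangle) (\<lambda>p. (centred u v p)\<^sup>2 * centred u' v' p)
     ((2 * u\<^sup>2 * u' - (u\<^sup>2 * v' + 2 * u * v * u') - (2 * u * v * v' + v\<^sup>2 * u') + 2 * v\<^sup>2 * v') / 540)"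
  by (rule has_bochner_integral_cong[THEN iffD1, OF refl _ _
        has_bochner_integral_unit_triangle_quadratics[of "(u + v)\<^sup>2 / 9" "- 2 * (u + v) * u / 3" "- 2 * (u + v) * v / 3"
          "u\<^sup>2" "2 * u * v" "v\<^sup>2" "- (u' + v') / 3" u' v' 0 0 0]])
     (auto simp: centred_def field_simps power2_eq_square)

lemma has_bochner_integral_centred4:
  "has_bochner_integral (restrict_space lborel unit_triangle) (\<lambda>p. (centred u v p)\<^sup>2 * (centred u' v' p)\<^sup>2)
     ((2 * u\<^sup>2 * u'\<^sup>2 - 2 * (u * v * u'\<^sup>2 + u\<^sup>2 * u' * v') + (u\<^sup>2 * v'\<^sup>2 + 4 * u * v * u' * v' + v\<^sup>2 * u'\<^sup>2)
       - 2 * (u * v * v'\<^sup>2 + v\<^sup>2 * u' * v') + 2 * v\<^sup>2 * v'\<^sup>2) / 540)"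
  by (rule has_bochner_integral_cong[THEN iffD1, OF refl _ _
        has_bochner_integral_unit_triangle_quadratics[of "(u + v)\<^sup>2 / 9" "- 2 * (u + v) * u / 3" "- 2 * (u + v) * v / 3"
          "u\<^sup>2" "2 * u * v" "v\<^sup>2" "(u' + v')\<^sup>2 / 9" "- 2 * (u' + v') * u' / 3" "- 2 * (u' + v') * v' / 3"
          "u'\<^sup>2" "2 * u' * v'" "v'\<^sup>2"]])
     (auto simp: centred_def field_simps power2_eq_square)

section \<open>Completing squares and moment identities\<close>

lemma complete_the_square:
  fixes c w :: complex and r :: real
  assumes "r \<noteq> 0"
  shows "r * (norm c)\<^sup>2 + 2 * Re (cnj c * w) = r * (norm (c + w / r))\<^sup>2 - (norm w)\<^sup>2 / r"
  using assms unfolding cmod_power2 by (simp add: field_simps power2_eq_square)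

text \<open>The left-hand side is the mean of \<open>|cnj z - c0 - c1 z - c2 z^2|^2\<close> for a centred \<open>z\<close> with
  \<open>V = E |z|^2\<close>, \<open>\<mu> = E z^2\<close>, \<open>\<kappa> = E z^3\<close>, \<open>\<tau> = E (z^2 cnj z)\<close> and \<open>F = E |z|^4\<close>.\<close>

lemma quadratic_form_complete_squares:
  fixes c0 c1 c2 \<mu> \<kappa> \<tau> \<eta> :: complex and V F G :: real
  assumes "V \<noteq> 0" "G \<noteq> 0" and G: "G = F - (norm \<mu>)\<^sup>2 - (norm \<tau>)\<^sup>2 / V" and \<eta>: "\<eta> = \<kappa> - \<tau> * \<mu> / V"
  shows "V + (norm c0)\<^sup>2 + V * (norm c1)\<^sup>2 + F * (norm c2)\<^sup>2 - 2 * Re (c1 * \<mu>) - 2 * Re (c2 * \<kappa>)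
           + 2 * Re (cnj c0 * c2 * \<mu>) + 2 * Re (c2 * cnj c1 * \<tau>)
       = V - (norm \<mu>)\<^sup>2 / V - (norm \<eta>)\<^sup>2 / G + (norm (c0 + c2 * \<mu>))\<^sup>2
           + V * (norm (c1 + (c2 * \<tau> - cnj \<mu>) / V))\<^sup>2 + G * (norm (c2 - cnj \<eta> / G))\<^sup>2"
proof -
  \<comment> \<open>The coefficients are eliminated in the order \<open>c0\<close>,
    \<open>c1\<close>, \<open>c2\<close>, as in Gram-Schmidt applied to 1, z, z^2; the first two are
    already orthogonal because z is centred.\<close>
  have 0: "(norm c0)\<^sup>2 + 2 * Re (cnj c0 * c2 * \<mu>) = (norm (c0 + c2 * \<mu>))\<^sup>2 - (norm c2)\<^sup>2 * (norm \<mu>)\<^sup>2"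
    using complete_the_square[of 1 c0 "c2 * \<mu>"] by (simp only: norm_mult power_mult_distrib mult.assoc) simp
  have 1: "V * (norm c1)\<^sup>2 + 2 * Re (c2 * cnj c1 * \<tau>) - 2 * Re (c1 * \<mu>)
      = V * (norm (c1 + (c2 * \<tau> - cnj \<mu>) / V))\<^sup>2 - (norm (c2 * \<tau> - cnj \<mu>))\<^sup>2 / V"
    using complete_the_square[OF \<open>V \<noteq> 0\<close>, of c1 "c2 * \<tau> - cnj \<mu>"] by (simp add: algebra_simps)
  have 2: "(norm (c2 * \<tau> - cnj \<mu>))\<^sup>2 = (norm c2)\<^sup>2 * (norm \<tau>)\<^sup>2 + (norm \<mu>)\<^sup>2 - 2 * Re (c2 * \<tau> * \<mu>)"
    unfolding cmod_power2 by (simp add: algebra_simps power2_eq_square)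
  \<comment> \<open>\<open>G\<close> is the squared norm of z^2 after projection off 1 and z, and
    \<open>\<eta>\<close> is the mean of that projected function times z, that is, its inner product
    with the conjugate.\<close>
  have 3: "G * (norm c2)\<^sup>2 - 2 * Re (c2 * \<eta>) = G * (norm (c2 - cnj \<eta> / G))\<^sup>2 - (norm \<eta>)\<^sup>2 / G"
    using complete_the_square[OF \<open>G \<noteq> 0\<close>, of c2 "- cnj \<eta>"] by simp
  have 4: "Re (c2 * \<eta>) = Re (c2 * \<kappa>) - Re (c2 * \<tau> * \<mu>) / V"
    by (simp add: \<eta> right_diff_distrib Re_divide_of_real mult.assoc[symmetric] del: times_complex.sel)
  have 5: "F * (norm c2)\<^sup>2 = G * (norm c2)\<^sup>2 + (norm c2)\<^sup>2 * (norm \<mu>)\<^sup>2 + (norm c2)\<^sup>2 * (norm \<tau>)\<^sup>2 / V"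
    by (simp add: G algebra_simps)
  have 6: "(norm (c2 * \<tau> - cnj \<mu>))\<^sup>2 / V = (norm c2)\<^sup>2 * (norm \<tau>)\<^sup>2 / V + (norm \<mu>)\<^sup>2 / V - 2 * (Re (c2 * \<tau> * \<mu>) / V)"
    unfolding 2 by (simp add: add_divide_distrib diff_divide_distrib)
  show ?thesis using 0 1 3 4 5 6 by linarith
qed

text \<open>In the next two identities \<open>u'\<close> and \<open>v'\<close> stand for the conjugates of \<open>u\<close> and \<open>v\<close>.\<close>

lemma third_moment_identity:
  fixes u v u' v' :: complex
  shows "(2 * u ^ 3 - 3 * u\<^sup>2 * v - 3 * u * v\<^sup>2 + 2 * v ^ 3) / 270 * ((2 * u * u' + 2 * v * v' - u * v' - v * u') / 36)
     - (2 * u\<^sup>2 * u' - (u\<^sup>2 * v' + 2 * u * v * u') - (2 * u * v * v' + v\<^sup>2 * u') + 2 * v\<^sup>2 * v') / 270 * ((u\<^sup>2 - u * v + v\<^sup>2) / 18)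
     = - (u' * v - u * v') * u * v * (u - v) / 1080"
  by (simp add: field_simps power2_eq_square power3_eq_cube)

lemma fourth_moment_identity:
  fixes u v u' v' :: complex
  assumes Q: "Q = 2 * u * u' + 2 * v * v' - u * v' - v * u'"
  shows "Q / 36 * ((2 * u\<^sup>2 * u'\<^sup>2 - 2 * (u * v * u'\<^sup>2 + u\<^sup>2 * u' * v') + (u\<^sup>2 * v'\<^sup>2 + 4 * u * v * u' * v' + v\<^sup>2 * u'\<^sup>2)
       - 2 * (u * v * v'\<^sup>2 + v\<^sup>2 * u' * v') + 2 * v\<^sup>2 * v'\<^sup>2) / 270 - (u\<^sup>2 - u * v + v\<^sup>2) / 18 * ((u'\<^sup>2 - u' * v' + v'\<^sup>2) / 18))
     - (2 * u\<^sup>2 * u' - (u\<^sup>2 * v' + 2 * u * v * u') - (2 * u * v * v' + v\<^sup>2 * u') + 2 * v\<^sup>2 * v') / 270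
       * ((2 * u'\<^sup>2 * u - (u'\<^sup>2 * v + 2 * u' * v' * u) - (2 * u' * v' * v + v'\<^sup>2 * u) + 2 * v'\<^sup>2 * v) / 270)
     = (Q * (3 * Q\<^sup>2 + (u' * v - u * v')\<^sup>2) + 48 * (u * u' * (v * v') * ((u - v) * (u' - v')))) / 129600"
  unfolding Q by (simp add: field_simps power2_eq_square power3_eq_cube)

text \<open>The denominator of \<rho>_2 for area 1, with \<open>k\<close> the product and
  \<open>c\<close> the inner product of the enclosing sides. The fraction decreases for large
  \<open>Q\<close>, so the growth of the first summand must be shown to outweigh it.\<close>

lemma rho_2_denominator_mono:
  fixes k c Q Q0 :: real
  assumes k: "k\<^sup>2 = c\<^sup>2 + 4" "0 < k" and Q0: "Q0 = 4 * k - 2 * c" and Q: "Q0 \<le> Q"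
  shows "Q0 + 48 * (k\<^sup>2 * (Q0 / 2 - c)) / (3 * Q0\<^sup>2 - 16) \<le> Q + 48 * (k\<^sup>2 * (Q / 2 - c)) / (3 * Q\<^sup>2 - 16)"
proof -
  \<comment> \<open>In terms of these nonnegative quantities, with \<open>a b = 4\<close>, all inequalities become evident from signs.\<close>
  define a b h where "a = k - c" and "b = k + c" and "h = Q - Q0"
  have "\<bar>c\<bar> < k" using k by (intro power2_less_imp_less[of "\<bar>c\<bar>" k]) auto
  then have ab: "0 < a" "0 < b" "0 \<le> h" using Q by (auto simp: a_def b_def h_def)
  have ab4: "a * b = 4" using k by (simp add: a_def b_def algebra_simps power2_eq_square)
  have kc: "k = (a + b) / 2" "c = (b - a) / 2" and Q': "Q0 = 3 * a + b" "Q = 3 * a + b + h"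
    by (auto simp: a_def b_def h_def Q0)
  define D0 where "D0 = 3 * Q0\<^sup>2 - 16"
  define D where "D = 3 * Q\<^sup>2 - 16"
  have D0: "D0 = 27 * a\<^sup>2 + 14 * (a * b) + 3 * b\<^sup>2" and D: "D = D0 + 6 * (Q0 * h) + 3 * h\<^sup>2"
    using ab4 unfolding D0_def D_def Q' by (simp_all add: algebra_simps power2_eq_square)
  have pos: "0 < D0" "0 < D"
    using ab unfolding D D0 Q' by (auto intro!: add_pos_nonneg add_nonneg_nonneg mult_nonneg_nonneg)
  \<comment> \<open>Chosen so that the difference of the fractions over \<open>D\<close> and
    \<open>D0\<close> has numerator \<open>- (h * R)\<close>; the claim becomes
    \<open>R \<le> D * D0\<close>.\<close>
  define R where "R = 48 * k\<^sup>2 * (3 / 2 * (Q * Q0) + 8 - 3 * c * (Q + Q0))"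
  have "D * D0 - R = 459 * a ^ 4 + a * b * (149 * a\<^sup>2 + 7 * (a - b)\<^sup>2 + 53 * b\<^sup>2) + 27 * b ^ 4
      + h * (414 * a ^ 3 + 270 * (a\<^sup>2 * b) + 66 * (a * b\<^sup>2) + 18 * b ^ 3) + 3 * D0 * h\<^sup>2"
  proof -
    \<comment> \<open>Writing the constant 8 as \<open>2 * (a * b)\<close> makes \<open>R\<close>
      homogeneous of degree four in \<open>a\<close>, \<open>b\<close>, \<open>h\<close>, so the
      expansion is a pure polynomial identity.\<close>
    have R: "R = 12 * (a + b)\<^sup>2 * (3 / 2 * (Q * Q0) + 2 * (a * b) - 3 / 2 * (b - a) * (Q + Q0))"
      unfolding R_def kc ab4 by (simp add: field_simps power2_eq_square)
    show ?thesis unfolding R D D0 Q' by (simp add: field_simps power2_eq_square power3_eq_cube power4_eq_xxxx)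
  qed
  also have "\<dots> \<ge> 0"
    using ab pos by (intro add_nonneg_nonneg mult_nonneg_nonneg) auto
  finally have "R \<le> D * D0" by simp
  have "(Q + 48 * (k\<^sup>2 * (Q / 2 - c)) / D) - (Q0 + 48 * (k\<^sup>2 * (Q0 / 2 - c)) / D0) = h * (D * D0 - R) / (D * D0)"
  proof -
    have "(Q + 48 * (k\<^sup>2 * (Q / 2 - c)) / D) - (Q0 + 48 * (k\<^sup>2 * (Q0 / 2 - c)) / D0)
       = (h * (D * D0) + 48 * k\<^sup>2 * ((Q / 2 - c) * D0 - (Q0 / 2 - c) * D)) / (D * D0)"
      using pos by (simp add: h_def field_simps)
    also have "48 * k\<^sup>2 * ((Q / 2 - c) * D0 - (Q0 / 2 - c) * D) = - (h * R)"
      unfolding R_def D_def D0_def h_def by (simp add: field_simps power2_eq_square)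
    finally show ?thesis by (simp add: algebra_simps)
  qed
  also have "\<dots> \<ge> 0" using ab pos \<open>R \<le> D * D0\<close> by simp
  finally show ?thesis by (simp add: D_def D0_def)
qed

section \<open>The minimal distances for a triangle\<close>

text \<open>Moments with respect to the centroid of the uniform distribution on a triangle whose edge vectors
  at one vertex are \<open>u\<close> and \<open>v\<close>.\<close>

definition second_abs_moment :: "complex \<Rightarrow> complex \<Rightarrow> real" where
  "second_abs_moment u v = ((norm u)\<^sup>2 + (norm v)\<^sup>2 + (norm (u - v))\<^sup>2) / 36"

definition second_moment :: "complex \<Rightarrow> complex \<Rightarrow> complex" where
  "second_moment u v = (u\<^sup>2 - u * v + v\<^sup>2) / 18"

definition third_moment :: "complex \<Rightarrow> complex \<Rightarrow> complex" where
  "third_moment u v = (2 * u ^ 3 - 3 * u\<^sup>2 * v - 3 * u * v\<^sup>2 + 2 * v ^ 3) / 270"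

definition mixed_moment :: "complex \<Rightarrow> complex \<Rightarrow> complex" where
  "mixed_moment u v = (2 * u\<^sup>2 * cnj u - (u\<^sup>2 * cnj v + 2 * u * v * cnj u)
     - (2 * u * v * cnj v + v\<^sup>2 * cnj u) + 2 * v\<^sup>2 * cnj v) / 270"

definition fourth_abs_moment :: "complex \<Rightarrow> complex \<Rightarrow> real" where
  "fourth_abs_moment u v = ((norm u) ^ 4 + (norm v) ^ 4 + (norm u)\<^sup>2 * (norm v)\<^sup>2
     + 2 * (u \<bullet> v)\<^sup>2 - 2 * (u \<bullet> v) * ((norm u)\<^sup>2 + (norm v)\<^sup>2)) / 135"

text \<open>Real quantities become polynomials in variables and conjugates, the form needed by the
  identities with independent primed variables.\<close>

lemma of_real_norm_power:
  "(complex_of_real (norm z))\<^sup>2 = z * cnj z" "(complex_of_real (norm z)) ^ 4 = (z * cnj z)\<^sup>2"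
proof -
  show 2: "(complex_of_real (norm z))\<^sup>2 = z * cnj z"
    by (metis complex_norm_square of_real_power)
  have "(complex_of_real (norm z)) ^ 4 = ((complex_of_real (norm z))\<^sup>2)\<^sup>2"
    by simp
  then show "(complex_of_real (norm z)) ^ 4 = (z * cnj z)\<^sup>2"
    unfolding 2 .
qed

lemma of_real_inner_complex: "complex_of_real (u \<bullet> v) = (u * cnj v + v * cnj u) / 2"
  by (simp add: complex_eq_iff inner_complex_def)

lemma of_real_second_abs_moment:
  "complex_of_real (second_abs_moment u v) = (2 * u * cnj u + 2 * v * cnj v - u * cnj v - v * cnj u) / 36"
  by (simp add: second_abs_moment_def of_real_norm_power algebra_simps)

lemma of_real_fourth_abs_moment:
  "complex_of_real (fourth_abs_moment u v) =
     (2 * u\<^sup>2 * (cnj u)\<^sup>2 - 2 * (u * v * (cnj u)\<^sup>2 + u\<^sup>2 * cnj u * cnj v)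
      + (u\<^sup>2 * (cnj v)\<^sup>2 + 4 * u * v * cnj u * cnj v + v\<^sup>2 * (cnj u)\<^sup>2)
      - 2 * (u * v * (cnj v)\<^sup>2 + v\<^sup>2 * cnj u * cnj v) + 2 * v\<^sup>2 * (cnj v)\<^sup>2) / 270"
  by (simp add: fourth_abs_moment_def of_real_norm_power of_real_inner_complex)
     (simp add: field_simps power2_eq_square)

text \<open>Expand the squared modulus as a product with its conjugate and integrate monomial by
  monomial; the final division by 2 is the area of the unit triangle.\<close>

lemma has_bochner_integral_norm_quadratic:
  "has_bochner_integral (restrict_space lborel unit_triangle)
     (\<lambda>p. (norm (cnj (centred u v p) - (c0 + c1 * centred u v p + c2 * (centred u v p)\<^sup>2)))\<^sup>2)
     ((second_abs_moment u v + (norm c0)\<^sup>2 + second_abs_moment u v * (norm c1)\<^sup>2 + fourth_abs_moment u v * (norm c2)\<^sup>2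
        - 2 * Re (c1 * second_moment u v) - 2 * Re (c2 * third_moment u v)
        + 2 * Re (cnj c0 * c2 * second_moment u v) + 2 * Re (c2 * cnj c1 * mixed_moment u v)) / 2)"
proof -
  let ?R = "restrict_space lborel unit_triangle"
  define z where "z = centred u v"
  define w where "w = centred (cnj u) (cnj v)"
  have w: "w p = cnj (z p)" for p by (simp add: z_def w_def centred_def)
  note mult = has_bochner_integral_mult_right
  define V F \<mu> \<kappa> \<tau> where "V = complex_of_real (second_abs_moment u v)" and "F = complex_of_real (fourth_abs_moment u v)"
    and "\<mu> = second_moment u v" and "\<kappa> = third_moment u v" and "\<tau> = mixed_moment u v"
  have m0: "has_bochner_integral ?R (\<lambda>p. 1) (1 / 2 :: complex)"
    using has_bochner_integral_unit_triangle_monomial[of 0 0] by (simp add: case_prod_beta')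
  have m10: "has_bochner_integral ?R z 0" and m01: "has_bochner_integral ?R w 0"
    unfolding z_def w_def by (rule has_bochner_integral_centred1)+
  have m20: "has_bochner_integral ?R (\<lambda>p. z p * z p) (\<mu> / 2)"
    and m02: "has_bochner_integral ?R (\<lambda>p. w p * w p) (cnj \<mu> / 2)"
    and m11: "has_bochner_integral ?R (\<lambda>p. z p * w p) (V / 2)"
    by (rule has_bochner_integral_cong[THEN iffD1, OF refl _ _ has_bochner_integral_centred2[of u v u v]],
        simp add: z_def, simp add: \<mu>_def second_moment_def field_simps power2_eq_square)
       (rule has_bochner_integral_cong[THEN iffD1, OF refl _ _ has_bochner_integral_centred2[of "cnj u" "cnj v" "cnj u" "cnj v"]],
        simp add: w_def, simp add: \<mu>_def second_moment_def field_simps power2_eq_square,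
        rule has_bochner_integral_cong[THEN iffD1, OF refl _ _ has_bochner_integral_centred2[of u v "cnj u" "cnj v"]],
        simp add: z_def w_def, simp add: V_def of_real_second_abs_moment)
  have m30: "has_bochner_integral ?R (\<lambda>p. (z p)\<^sup>2 * z p) (\<kappa> / 2)"
    and m03: "has_bochner_integral ?R (\<lambda>p. (w p)\<^sup>2 * w p) (cnj \<kappa> / 2)"
    and m21: "has_bochner_integral ?R (\<lambda>p. (z p)\<^sup>2 * w p) (\<tau> / 2)"
    and m12: "has_bochner_integral ?R (\<lambda>p. (w p)\<^sup>2 * z p) (cnj \<tau> / 2)"
    using has_bochner_integral_centred3[of u v u v] has_bochner_integral_centred3[of "cnj u" "cnj v" "cnj u" "cnj v"]
      has_bochner_integral_centred3[of u v "cnj u" "cnj v"] has_bochner_integral_centred3[of "cnj u" "cnj v" u v]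
    by (simp_all add: z_def w_def \<kappa>_def \<tau>_def third_moment_def mixed_moment_def power2_eq_square power3_eq_cube algebra_simps)
  have m22: "has_bochner_integral ?R (\<lambda>p. (z p)\<^sup>2 * (w p)\<^sup>2) (F / 2)"
    using has_bochner_integral_centred4[of u v "cnj u" "cnj v"]
    by (simp add: z_def w_def F_def of_real_fourth_abs_moment)
  note add = has_bochner_integral_add
  \<comment> \<open>The sixteen products of the two four-term factors. First-order monomials must
    appear in the integrand although they integrate to zero.\<close>
  note I = add[OF add[OF add[OF m11 add[OF mult[OF m02, of "- cnj c1"] mult[OF m03, of "- cnj c2"]]]
       add[OF mult[OF m0, of "c0 * cnj c0"] add[OF mult[OF m10, of "- c0 + c1 * - (- cnj c0)"]
         add[OF mult[OF m01, of "- cnj c0 + c0 * cnj c1"] mult[OF m02, of "c0 * cnj c2"]]]]]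
     add[OF add[OF mult[OF m20, of "- c1"] add[OF mult[OF m11, of "c1 * cnj c1"] mult[OF m12, of "c1 * cnj c2"]]]
       add[OF add[OF mult[OF m20, of "c2 * cnj c0"] mult[OF m30, of "- c2"]]
         add[OF mult[OF m21, of "c2 * cnj c1"] mult[OF m22, of "c2 * cnj c2"]]]]]
  have "has_bochner_integral ?R (\<lambda>p. (w p - (c0 + c1 * z p + c2 * (z p)\<^sup>2)) * (z p - (cnj c0 + cnj c1 * w p + cnj c2 * (w p)\<^sup>2)))
    ((V + c0 * cnj c0 + V * (c1 * cnj c1) + F * (c2 * cnj c2) - (c1 * \<mu> + cnj (c1 * \<mu>)) - (c2 * \<kappa> + cnj (c2 * \<kappa>))
     + (cnj c0 * c2 * \<mu> + cnj (cnj c0 * c2 * \<mu>)) + (c2 * cnj c1 * \<tau> + cnj (c2 * cnj c1 * \<tau>))) / 2)"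
    by (rule has_bochner_integral_cong[THEN iffD1, OF refl _ _ I])
       (simp_all add: field_simps power2_eq_square)
  from has_bochner_integral_bounded_linear[OF bounded_linear_Re this] show ?thesis
  proof (rule has_bochner_integral_cong[THEN iffD1, rotated 3])
    fix p
    let ?e = "cnj (z p) - (c0 + c1 * z p + c2 * (z p)\<^sup>2)"
    have "(w p - (c0 + c1 * z p + c2 * (z p)\<^sup>2)) * (z p - (cnj c0 + cnj c1 * w p + cnj c2 * (w p)\<^sup>2)) = of_real ((norm ?e)\<^sup>2)"
      unfolding complex_norm_square by (simp add: w)
    then show "Re ((w p - (c0 + c1 * z p + c2 * (z p)\<^sup>2)) * (z p - (cnj c0 + cnj c1 * w p + cnj c2 * (w p)\<^sup>2)))
       = (norm (cnj (centred u v p) - (c0 + c1 * centred u v p + c2 * (centred u v p)\<^sup>2)))\<^sup>2"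
      by (simp only: Re_complex_of_real z_def)
  next
    show "Re ((V + c0 * cnj c0 + V * (c1 * cnj c1) + F * (c2 * cnj c2) - (c1 * \<mu> + cnj (c1 * \<mu>)) - (c2 * \<kappa> + cnj (c2 * \<kappa>))
       + (cnj c0 * c2 * \<mu> + cnj (cnj c0 * c2 * \<mu>)) + (c2 * cnj c1 * \<tau> + cnj (c2 * cnj c1 * \<tau>))) / 2)
      = (second_abs_moment u v + (norm c0)\<^sup>2 + second_abs_moment u v * (norm c1)\<^sup>2 + fourth_abs_moment u v * (norm c2)\<^sup>2
        - 2 * Re (c1 * second_moment u v) - 2 * Re (c2 * third_moment u v)
        + 2 * Re (cnj c0 * c2 * second_moment u v) + 2 * Re (c2 * cnj c1 * mixed_moment u v)) / 2"
      unfolding complex_add_cnj complex_norm_square[symmetric] V_def F_def \<mu>_def \<kappa>_def \<tau>_def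
        of_real_mult[symmetric] of_real_add[symmetric] of_real_diff[symmetric]
      by (simp only: Re_divide_numeral Re_complex_of_real)
  qed simp
qed

section \<open>Closed forms for the combinations of moments in the minima\<close>

lemma Im_cnj_mult_power2: "(Im (cnj u * v))\<^sup>2 = (norm u)\<^sup>2 * (norm v)\<^sup>2 - (u \<bullet> v)\<^sup>2"
  unfolding cmod_power2 by (simp add: inner_complex_def algebra_simps power2_eq_square)

text \<open>The left-hand side is four times the determinant of the covariance matrix, which an
  affine map multiplies by its squared Jacobian.\<close>

lemma second_moment_gap:
  "(second_abs_moment u v)\<^sup>2 - (norm (second_moment u v))\<^sup>2 = (Im (cnj u * v))\<^sup>2 / 108"
proof -
  have "(norm (second_moment u v))\<^sup>2 = (norm (u\<^sup>2 - u * v + v\<^sup>2))\<^sup>2 / 324"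
    by (simp add: second_moment_def norm_divide power_divide)
  then show ?thesis
    unfolding second_abs_moment_def cmod_power2 by (simp add: field_simps power2_eq_square)
qed

text \<open>This is |V \<eta>|^2 in the notation of the completed squares. Before taking norms, the
  residual factors into the determinant and the three edge vectors.\<close>

lemma norm_third_moment_residual:
  "(norm (third_moment u v * second_abs_moment u v - mixed_moment u v * second_moment u v))\<^sup>2
     = (Im (cnj u * v))\<^sup>2 * ((norm u)\<^sup>2 * (norm v)\<^sup>2 * (norm (u - v))\<^sup>2) / 291600"
proof -
  have "third_moment u v * second_abs_moment u v - mixed_moment u v * second_moment u v
      = - (cnj u * v - u * cnj v) * u * v * (u - v) / 1080"
    unfolding of_real_second_abs_moment third_moment_def mixed_moment_def second_moment_def
    by (rule third_moment_identity)
  also have "cnj u * v - u * cnj v = 2 * \<i> * Im (cnj u * v)"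
    by (simp add: complex_eq_iff)
  finally show ?thesis
    by (simp add: norm_mult norm_divide power_mult_distrib power_divide del: times_complex.sel)
qed

text \<open>This is V G in the notation of the completed squares. The claim is embedded into the
  complex numbers, where \<open>fourth_moment_identity\<close> applies with conjugates as primed
  variables.\<close>

lemma fourth_moment_residual:
  assumes Q: "Q = (norm u)\<^sup>2 + (norm v)\<^sup>2 + (norm (u - v))\<^sup>2"
  shows "second_abs_moment u v * (fourth_abs_moment u v - (norm (second_moment u v))\<^sup>2) - (norm (mixed_moment u v))\<^sup>2
     = (Q * (3 * Q\<^sup>2 - 4 * (Im (cnj u * v))\<^sup>2) + 48 * ((norm u)\<^sup>2 * (norm v)\<^sup>2 * (norm (u - v))\<^sup>2)) / 129600"
    (is "?l = ?r")
proof -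
  define q where "q = 2 * u * cnj u + 2 * v * cnj v - u * cnj v - v * cnj u"
  have Q': "complex_of_real Q = q"
    by (simp add: Q q_def of_real_norm_power algebra_simps)
  \<comment> \<open>The difference is purely imaginary, whence the negative sign.\<close>
  have I: "(cnj u * v - u * cnj v)\<^sup>2 = - 4 * (of_real (Im (cnj u * v)))\<^sup>2"
  proof -
    have "cnj u * v - u * cnj v = 2 * \<i> * Im (cnj u * v)"
      by (simp add: complex_eq_iff)
    then show ?thesis by (simp add: power_mult_distrib del: times_complex.sel)
  qed
  note id = fourth_moment_identity[OF q_def, unfolded I]
  have "complex_of_real ?l = complex_of_real ?r"
    unfolding of_real_diff of_real_mult of_real_power of_real_second_abs_moment of_real_fourth_abs_moment
      of_real_add of_real_divide of_real_norm_power Q' q_def[symmetric]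
    using id by (simp add: second_moment_def mixed_moment_def del: times_complex.sel)
  then show ?thesis by (simp only: of_real_eq_iff)
qed

text \<open>Expanding the polynomial about the centroid \<open>g\<close> gives \<open>c1\<close>
  and, after absorbing the constant \<open>cnj g\<close>, \<open>c0\<close>; the leading coefficient
  is unchanged.\<close>

lemma set_integral_triangle_quadratic:
  fixes a b c a0 a1 a2 :: complex
  assumes nc: "\<not> collinear {a, b, c}"
  defines "u \<equiv> b - a" and "v \<equiv> c - a" and "g \<equiv> (a + b + c) / 3"
  defines "c0 \<equiv> a0 + a1 * g + a2 * g\<^sup>2 - cnj g" and "c1 \<equiv> a1 + 2 * a2 * g"
  shows "(LINT z:triangle_region a b c|lborel. (norm (cnj z - poly [:a0, a1, a2:] z))\<^sup>2)
     = measure lborel (triangle_region a b c) *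
       (second_abs_moment u v + (norm c0)\<^sup>2 + second_abs_moment u v * (norm c1)\<^sup>2 + fourth_abs_moment u v * (norm a2)\<^sup>2
        - 2 * Re (c1 * second_moment u v) - 2 * Re (a2 * third_moment u v)
        + 2 * Re (cnj c0 * a2 * second_moment u v) + 2 * Re (a2 * cnj c1 * mixed_moment u v))"
proof -
  have [measurable]: "(\<lambda>z. (norm (cnj z - poly [:a0, a1, a2:] z))\<^sup>2) \<in> borel_measurable borel"
    by (intro borel_measurable_continuous_onI continuous_intros)
  have "norm (cnj (a + of_real x * u + of_real y * v) - poly [:a0, a1, a2:] (a + of_real x * u + of_real y * v))
    = norm (cnj (centred u v (x, y)) - (c0 + c1 * centred u v (x, y) + a2 * (centred u v (x, y))\<^sup>2))" for x y
  proof -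
    define s where "s = centred u v (x, y)"
    have "a + of_real x * u + of_real y * v = g + s"
      by (simp add: s_def centred_def g_def u_def v_def field_simps)
    then show ?thesis unfolding s_def[symmetric]
      by (simp add: c0_def c1_def algebra_simps power2_eq_square)
  qed
  then have "(LINT z:triangle_region a b c|lborel. (norm (cnj z - poly [:a0, a1, a2:] z))\<^sup>2)
    = \<bar>Im (cnj u * v)\<bar> * (LINT p|restrict_space lborel unit_triangle.
       (norm (cnj (centred u v p) - (c0 + c1 * centred u v p + a2 * (centred u v p)\<^sup>2)))\<^sup>2)"
    by (subst set_integral_triangle_region[OF nc]) (simp_all add: case_prod_beta' u_def v_def del: times_complex.sel poly_pCons)
  also note has_bochner_integral_integral_eq[OF has_bochner_integral_norm_quadratic]
  finally show ?thesis
    unfolding measure_triangle_region[OF nc] u_def[symmetric] v_def[symmetric] by simp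
qed

section \<open>Exact minima for degrees one and two\<close>

lemma rho_eqI:
  assumes "\<And>p. degree p \<le> N \<Longrightarrow> m \<le> (LINT z:\<Omega>|lborel. (norm (cnj z - poly p z))\<^sup>2)"
    and "degree p \<le> N" "(LINT z:\<Omega>|lborel. (norm (cnj z - poly p z))\<^sup>2) = m"
  shows "rho N \<Omega> = m"
  unfolding rho_def using assms by (intro cInf_eq_minimum) auto

lemma poly_eq_quadratic:
  fixes p :: "'a :: comm_semiring_1 poly"
  assumes "degree p \<le> 2"
  shows "p = [:coeff p 0, coeff p 1, coeff p 2:]"
proof (rule poly_eqI)
  fix n show "coeff p n = coeff [:coeff p 0, coeff p 1, coeff p 2:] n"
    using coeff_eq_0[of p n] assms by (auto simp: coeff_pCons numeral_2_eq_2 split: nat.splits)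
qed

lemma triangle_moments_pos:
  assumes "Im (cnj u * v) \<noteq> 0" and Q: "Q = (norm u)\<^sup>2 + (norm v)\<^sup>2 + (norm (u - v))\<^sup>2"
  shows "0 < second_abs_moment u v" "4 * (Im (cnj u * v))\<^sup>2 < 3 * Q\<^sup>2" "0 < Q"
    "0 < (norm u)\<^sup>2 * (norm v)\<^sup>2 * (norm (u - v))\<^sup>2"
proof -
  have "u \<noteq> 0" "v \<noteq> 0" "u \<noteq> v" using assms(1) by auto
  then show "0 < Q" "0 < (norm u)\<^sup>2 * (norm v)\<^sup>2 * (norm (u - v))\<^sup>2"
    by (simp_all add: Q add_pos_nonneg)
  then show "0 < second_abs_moment u v" by (simp add: second_abs_moment_def Q)
  \<comment> \<open>Nonnegativity of the squared norm in \<open>second_moment_gap\<close> yields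
    Weitzenboeck's inequality, here as \<open>12 * (Im (cnj u * v))^2 \<le> Q^2\<close>; it keeps
    the denominator of \<rho>_2 positive.\<close>
  have "(Im (cnj u * v))\<^sup>2 / 108 \<le> (second_abs_moment u v)\<^sup>2"
    unfolding second_moment_gap[symmetric] by simp
  also have "\<dots> = Q\<^sup>2 / 1296" by (simp add: second_abs_moment_def Q power_divide)
  finally have "12 * (Im (cnj u * v))\<^sup>2 \<le> Q\<^sup>2" by simp
  moreover have "0 < (Im (cnj u * v))\<^sup>2" using assms(1) by (simp del: times_complex.sel)
  ultimately show "4 * (Im (cnj u * v))\<^sup>2 < 3 * Q\<^sup>2" by linarith
qed

lemma rho_1_triangle_region:
  assumes nc: "\<not> collinear {a, b, c}"
  defines "A \<equiv> measure lborel (triangle_region a b c)"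
  defines "Q \<equiv> (norm (b - a))\<^sup>2 + (norm (c - a))\<^sup>2 + (norm (b - c))\<^sup>2"
  shows "rho 1 (triangle_region a b c) = 4 / 3 * A ^ 3 / Q"
proof -
  define u v g where "u = b - a" and "v = c - a" and "g = (a + b + c) / 3"
  define V \<mu> where "V = second_abs_moment u v" and "\<mu> = second_moment u v"
  have nz: "Im (cnj u * v) \<noteq> 0"
    unfolding u_def v_def by (rule Im_cnj_mult_nonzero_if_not_collinear[OF nc])
  have Q: "Q = (norm u)\<^sup>2 + (norm v)\<^sup>2 + (norm (u - v))\<^sup>2" by (simp add: Q_def u_def v_def)
  note pos = triangle_moments_pos[OF nz Q, folded V_def]
  have A: "A = \<bar>Im (cnj u * v)\<bar> / 2"
    unfolding A_def u_def v_def by (rule measure_triangle_region[OF nc])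
  define m where "m = A * (V - (norm \<mu>)\<^sup>2 / V)"
  have I: "(LINT z:triangle_region a b c|lborel. (norm (cnj z - poly [:a0, a1, 0:] z))\<^sup>2)
    = m + A * ((norm (a0 + a1 * g - cnj g))\<^sup>2 + V * (norm (a1 - cnj \<mu> / V))\<^sup>2)" for a0 a1
  proof -
    have "V * (norm a1)\<^sup>2 - 2 * Re (a1 * \<mu>) = V * (norm (a1 - cnj \<mu> / V))\<^sup>2 - (norm \<mu>)\<^sup>2 / V"
      using complete_the_square[of V a1 "- cnj \<mu>"] pos(1) by simp
    then show ?thesis
      unfolding set_integral_triangle_quadratic[OF nc] m_def u_def[symmetric] v_def[symmetric] g_def[symmetric]
        V_def[symmetric] \<mu>_def[symmetric] A_def[symmetric] distrib_left[symmetric]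
      by (intro arg_cong2[of _ _ _ _ "(*)"] refl) simp
  qed
  have "rho 1 (triangle_region a b c) = m"
  proof (rule rho_eqI)
    fix p :: "complex poly" assume "degree p \<le> 1"
    then have "p = [:coeff p 0, coeff p 1, 0:]"
      using poly_eq_quadratic[of p] coeff_eq_0[of p 2] by simp
    then show "m \<le> (LINT z:triangle_region a b c|lborel. (norm (cnj z - poly p z))\<^sup>2)"
      using I[of "coeff p 0" "coeff p 1"] pos(1) by (simp add: A_def)
  next
    \<comment> \<open>The coefficients that make both squares in \<open>I\<close> vanish.\<close>
    show "degree [:cnj g - cnj \<mu> / V * g, cnj \<mu> / V, 0:] \<le> 1" by simp
    show "(LINT z:triangle_region a b c|lborel. (norm (cnj z - poly [:cnj g - cnj \<mu> / V * g, cnj \<mu> / V, 0:] z))\<^sup>2) = m"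
      unfolding I by simp
  qed
  also have "\<dots> = A * ((V\<^sup>2 - (norm \<mu>)\<^sup>2) / V)"
    unfolding m_def using pos(1) by (simp add: field_simps power2_eq_square)
  also have "V\<^sup>2 - (norm \<mu>)\<^sup>2 = A\<^sup>2 / 27"
    unfolding V_def \<mu>_def second_moment_gap A by (simp add: power_divide del: times_complex.sel)
  also have "V = Q / 36" by (simp add: V_def second_abs_moment_def Q)
  finally show ?thesis
    by (simp add: power2_eq_square power3_eq_cube)
qed

text \<open>The completed squares give the minimum through \<open>V\<close>, \<open>\<mu>\<close>,
  \<open>\<eta>\<close> and \<open>G\<close>. Multiplying by \<open>V\<close> clears the inner
  fractions, so the residual lemmas supply closed forms for \<open>V * G\<close> and
  \<open>V * norm \<eta>\<close>.\<close>

lemma rho_2_triangle_region: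
  assumes nc: "\<not> collinear {a, b, c}"
  defines "A \<equiv> measure lborel (triangle_region a b c)"
  defines "Q \<equiv> (norm (b - a))\<^sup>2 + (norm (c - a))\<^sup>2 + (norm (b - c))\<^sup>2"
  defines "\<Xi> \<equiv> (norm (b - a))\<^sup>2 * (norm (c - a))\<^sup>2 * (norm (b - c))\<^sup>2"
  shows "rho 2 (triangle_region a b c) = 4 / 3 * A ^ 3 / (Q + 48 * \<Xi> / (3 * Q\<^sup>2 - 16 * A\<^sup>2))"
proof -
  define u v g where "u = b - a" and "v = c - a" and "g = (a + b + c) / 3"
  define V F \<mu> \<kappa> \<tau> where "V = second_abs_moment u v" and "F = fourth_abs_moment u v"
    and "\<mu> = second_moment u v" and "\<kappa> = third_moment u v" and "\<tau> = mixed_moment u v"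
  have nz: "Im (cnj u * v) \<noteq> 0"
    unfolding u_def v_def by (rule Im_cnj_mult_nonzero_if_not_collinear[OF nc])
  have Q: "Q = (norm u)\<^sup>2 + (norm v)\<^sup>2 + (norm (u - v))\<^sup>2" by (simp add: Q_def u_def v_def)
  have \<Xi>: "\<Xi> = (norm u)\<^sup>2 * (norm v)\<^sup>2 * (norm (u - v))\<^sup>2" by (simp add: \<Xi>_def u_def v_def)
  have A: "A = \<bar>Im (cnj u * v)\<bar> / 2"
    unfolding A_def u_def v_def by (rule measure_triangle_region[OF nc])
  have A2: "(Im (cnj u * v))\<^sup>2 = 4 * A\<^sup>2" unfolding A by (simp add: power_divide del: times_complex.sel)
  note pos = triangle_moments_pos[OF nz Q, unfolded A2, folded V_def \<Xi>]
  \<comment> \<open>\<open>W\<close> is 129600 times \<open>V * G\<close>, and equals the claimed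
    denominator times \<open>3 * Q^2 - 16 * A^2\<close>.\<close>
  define W where "W = Q * (3 * Q\<^sup>2 - 16 * A\<^sup>2) + 48 * \<Xi>"
  have W: "0 < W" using pos unfolding W_def by (intro add_pos_pos mult_pos_pos) auto
  define G \<eta> where "G = F - (norm \<mu>)\<^sup>2 - (norm \<tau>)\<^sup>2 / V" and "\<eta> = \<kappa> - \<tau> * \<mu> / V"
  have "V * G = V * (F - (norm \<mu>)\<^sup>2) - (norm \<tau>)\<^sup>2"
    using pos(1) by (simp add: G_def field_simps)
  also have "\<dots> = W / 129600"
    unfolding V_def F_def \<mu>_def \<tau>_def fourth_moment_residual[OF Q] A2 by (simp add: W_def \<Xi>)
  finally have VG: "V * G = W / 129600" .
  then have G: "0 < G" using W pos(1) by (metis divide_pos_pos zero_less_mult_pos zero_less_numeral)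
  have "V * norm \<eta> = norm (\<kappa> * V - \<tau> * \<mu>)"
  proof -
    have "\<kappa> * V - \<tau> * \<mu> = V * \<eta>" using pos(1) by (simp add: \<eta>_def field_simps)
    then show ?thesis using pos(1) by (simp add: norm_mult)
  qed
  then have "(V * norm \<eta>)\<^sup>2 = A\<^sup>2 * \<Xi> / 72900"
    unfolding V_def \<kappa>_def \<mu>_def \<tau>_def norm_third_moment_residual A2 \<Xi>[symmetric]
    by (simp add: norm_third_moment_residual A2 \<Xi> del: times_complex.sel)
  then have \<eta>: "(norm \<eta>)\<^sup>2 / G = 16 * A\<^sup>2 * \<Xi> / (9 * V * W)"
  proof -
    have "(norm \<eta>)\<^sup>2 / G = (V * norm \<eta>)\<^sup>2 / (V * (V * G))"
      using G pos(1) by (simp add: power2_eq_square)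
    also have "\<dots> = A\<^sup>2 * \<Xi> / 72900 / (V * (W / 129600))"
      unfolding VG \<open>(V * norm \<eta>)\<^sup>2 = A\<^sup>2 * \<Xi> / 72900\<close> ..
    finally show ?thesis by (simp add: mult.commute mult.left_commute)
  qed
  define m where "m = A * (V - (norm \<mu>)\<^sup>2 / V - (norm \<eta>)\<^sup>2 / G)"
  have I: "(LINT z:triangle_region a b c|lborel. (norm (cnj z - poly [:a0, a1, a2:] z))\<^sup>2)
    = m + A * ((norm (a0 + a1 * g + a2 * g\<^sup>2 - cnj g + a2 * \<mu>))\<^sup>2
        + V * (norm (a1 + 2 * a2 * g + (a2 * \<tau> - cnj \<mu>) / V))\<^sup>2 + G * (norm (a2 - cnj \<eta> / G))\<^sup>2)" for a0 a1 a2
    unfolding set_integral_triangle_quadratic[OF nc] m_def u_def[symmetric] v_def[symmetric] g_def[symmetric]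
      V_def[symmetric] F_def[symmetric] \<mu>_def[symmetric] \<kappa>_def[symmetric] \<tau>_def[symmetric] A_def[symmetric]
      distrib_left[symmetric]
    by (subst quadratic_form_complete_squares[OF _ _ G_def \<eta>_def]) (use pos(1) G in \<open>simp_all add: algebra_simps\<close>)
  \<comment> \<open>The vanishing of the three squares is a triangular system, solved from the
    leading coefficient down.\<close>
  define a2 where "a2 = cnj \<eta> / G"
  define a1 where "a1 = (cnj \<mu> - a2 * \<tau>) / V - 2 * a2 * g"
  define a0 where "a0 = cnj g - a2 * \<mu> - a2 * g\<^sup>2 - a1 * g"
  have "rho 2 (triangle_region a b c) = m"
  proof (rule rho_eqI)
    fix p :: "complex poly" assume "degree p \<le> 2"
    note p = poly_eq_quadratic[OF this]
    show "m \<le> (LINT z:triangle_region a b c|lborel. (norm (cnj z - poly p z))\<^sup>2)"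
      by (subst p, subst I) (use pos(1) G in \<open>simp add: A_def\<close>)
  next
    show "degree [:a0, a1, a2:] \<le> 2" by simp
    have "a0 + a1 * g + a2 * g\<^sup>2 - cnj g + a2 * \<mu> = 0" by (simp add: a0_def)
    moreover have "a1 + 2 * a2 * g + (a2 * \<tau> - cnj \<mu>) / V = 0"
      unfolding a1_def by (simp add: diff_divide_distrib)
    moreover have "a2 - cnj \<eta> / G = 0" by (simp add: a2_def)
    ultimately show "(LINT z:triangle_region a b c|lborel. (norm (cnj z - poly [:a0, a1, a2:] z))\<^sup>2) = m"
      unfolding I by simp
  qed
  also have "\<dots> = A * ((V\<^sup>2 - (norm \<mu>)\<^sup>2) / V - (norm \<eta>)\<^sup>2 / G)"
    unfolding m_def using pos(1) by (simp add: field_simps power2_eq_square)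
  also have "V\<^sup>2 - (norm \<mu>)\<^sup>2 = A\<^sup>2 / 27"
    unfolding V_def \<mu>_def second_moment_gap A2 by simp
  finally have "rho 2 (triangle_region a b c) = A * (A\<^sup>2 / 27 / V - 16 * A\<^sup>2 * \<Xi> / (9 * V * W))"
    unfolding \<eta> .
  \<comment> \<open>With this factor extracted, \<open>48 * \<Xi>\<close> cancels from
    \<open>W\<close>, and the remaining factor \<open>Q\<close> cancels against
    \<open>V = Q / 36\<close>.\<close>
  also have "\<dots> = A ^ 3 / (27 * V) * ((W - 48 * \<Xi>) / W)"
    using W pos(1) by (simp add: field_simps power2_eq_square power3_eq_cube)
  also have "V = Q / 36" by (simp add: V_def second_abs_moment_def Q)
  also have "W - 48 * \<Xi> = Q * (3 * Q\<^sup>2 - 16 * A\<^sup>2)" by (simp add: W_def)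
  also have "A ^ 3 / (27 * (Q / 36)) * (Q * (3 * Q\<^sup>2 - 16 * A\<^sup>2) / W) = 4 / 3 * A ^ 3 / (W / (3 * Q\<^sup>2 - 16 * A\<^sup>2))"
    using pos W by simp
  also have "W / (3 * Q\<^sup>2 - 16 * A\<^sup>2) = Q + 48 * \<Xi> / (3 * Q\<^sup>2 - 16 * A\<^sup>2)"
    using pos(2) by (simp add: W_def add_divide_distrib)
  finally show ?thesis .
qed

section \<open>Triangles with a prescribed angle\<close>

text \<open>Area 1 makes the determinant 2 in absolute value. Lagrange's identity
  \<open>Im_cnj_mult_power2\<close> then reads \<open>k^2 - i^2 = 4\<close>, and
  \<open>i = k * cos \<theta>\<close> turns it into \<open>k * sin \<theta> = 2\<close>.\<close>

lemma angle_triangle_invariants: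
  fixes a b c :: complex
  assumes \<theta>: "0 < \<theta>" "\<theta> < pi" and nc: "\<not> collinear {a, b, c}"
    and A: "measure lborel (triangle_region a b c) = 1" and angle: "angle_at a b c = \<theta>"
  shows "norm (b - a) * norm (c - a) = 2 / sin \<theta>" "(b - a) \<bullet> (c - a) = 2 / sin \<theta> * cos \<theta>"
proof -
  define k i where "k = norm (b - a) * norm (c - a)" and "i = (b - a) \<bullet> (c - a)"
  have s: "0 < sin \<theta>" using \<theta> by (rule sin_gt_zero)
  have "a \<noteq> b" "a \<noteq> c" using nc by (auto simp: insert_commute)
  then have k: "0 < k" by (simp add: k_def)
  \<comment> \<open>Cauchy-Schwarz puts the argument of \<open>arccos\<close> into [-1, 1], so
    \<open>arccos\<close> can be inverted.\<close>
  have "\<bar>i\<bar> \<le> k" unfolding i_def k_def by (rule Cauchy_Schwarz_ineq2)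
  then have "\<bar>i / k\<bar> \<le> 1" using k by simp
  then have "cos \<theta> = i / k"
    unfolding angle[symmetric] angle_at_def i_def[symmetric] k_def[symmetric] by (intro cos_arccos_abs)
  then have i: "i = k * cos \<theta>" using k by simp
  have "\<bar>Im (cnj (b - a) * (c - a))\<bar> = 2"
    using A unfolding measure_triangle_region[OF nc] by simp
  then have "(Im (cnj (b - a) * (c - a)))\<^sup>2 = 2\<^sup>2" by (metis power2_abs)
  then have "k\<^sup>2 - i\<^sup>2 = 2\<^sup>2"
    unfolding Im_cnj_mult_power2 by (simp add: k_def i_def power_mult_distrib)
  then have "(k * sin \<theta>)\<^sup>2 = 2\<^sup>2"
    unfolding i by (simp add: power_mult_distrib sin_squared_eq algebra_simps)
  then have "k * sin \<theta> = 2" using k s by (intro power2_eq_imp_eq[of _ 2]) simp_all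
  then show k2: "norm (b - a) * norm (c - a) = 2 / sin \<theta>" using s by (simp add: k_def field_simps)
  show "(b - a) \<bullet> (c - a) = 2 / sin \<theta> * cos \<theta>" using i k2 by (simp add: k_def i_def)
qed

text \<open>The law of cosines eliminates the third side, leaving \<open>Q\<close> as the only
  varying quantity. The last equation isolates the squared difference of the enclosing sides, which
  vanishes exactly in the isosceles case.\<close>

lemma rho_angle_triangle:
  fixes a b c :: complex
  assumes \<theta>: "0 < \<theta>" "\<theta> < pi" and nc: "\<not> collinear {a, b, c}"
    and A: "measure lborel (triangle_region a b c) = 1" and angle: "angle_at a b c = \<theta>"
  defines "k \<equiv> 2 / sin \<theta>" and "i \<equiv> 2 / sin \<theta> * cos \<theta>"
  defines "Q \<equiv> 2 * ((norm (b - a))\<^sup>2 + (norm (c - a))\<^sup>2) - 2 * i"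
  shows "rho 1 (triangle_region a b c) = 4 / 3 / Q"
    "rho 2 (triangle_region a b c) = 4 / 3 / (Q + 48 * (k\<^sup>2 * (Q / 2 - i)) / (3 * Q\<^sup>2 - 16))"
    "Q = 4 * k - 2 * i + 2 * (norm (b - a) - norm (c - a))\<^sup>2"
proof -
  note inv = angle_triangle_invariants[OF assms(1-5), folded k_def i_def]
  have bc: "(norm (b - c))\<^sup>2 = (norm (b - a))\<^sup>2 + (norm (c - a))\<^sup>2 - 2 * i"
    using dot_norm_neg[of "b - a" "c - a"] inv(2) by simp
  have Q: "(norm (b - a))\<^sup>2 + (norm (c - a))\<^sup>2 + (norm (b - c))\<^sup>2 = Q"
    and Q': "(norm (b - c))\<^sup>2 = Q / 2 - i"
    unfolding bc Q_def by (simp_all add: add_divide_distrib diff_divide_distrib)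
  have k2: "(norm (b - a))\<^sup>2 * (norm (c - a))\<^sup>2 = k\<^sup>2"
    unfolding inv(1)[symmetric] by (simp add: power_mult_distrib)
  show "rho 1 (triangle_region a b c) = 4 / 3 / Q"
    unfolding rho_1_triangle_region[OF nc] Q A by simp
  show "rho 2 (triangle_region a b c) = 4 / 3 / (Q + 48 * (k\<^sup>2 * (Q / 2 - i)) / (3 * Q\<^sup>2 - 16))"
    unfolding rho_2_triangle_region[OF nc] Q unfolding k2 Q' A by simp
  show "Q = 4 * k - 2 * i + 2 * (norm (b - a) - norm (c - a))\<^sup>2"
    unfolding Q_def inv(1)[symmetric] by (simp add: power2_diff)
qed

lemma isosceles_angle_triangles_nonempty:
  assumes \<theta>: "0 < \<theta>" "\<theta> < pi"
  shows "isosceles_angle_triangles \<theta> \<noteq> {}"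
proof -
  have s: "0 < sin \<theta>" using \<theta> by (rule sin_gt_zero)
  \<comment> \<open>The leg length for which the area \<open>r^2 * sin \<theta> / 2\<close> is 1;
    the apex is placed at the origin.\<close>
  define r where "r = sqrt (2 / sin \<theta>)"
  have r: "0 < r" and r2: "r * r = 2 / sin \<theta>" using s by (simp_all add: r_def)
  define b c where "b = complex_of_real r" and "c = of_real r * cis \<theta>"
  have nc: "\<not> collinear {0, b, c}"
    using r s by (simp add: collinear_iff_Reals b_def c_def complex_is_Real_iff)
  have "measure lborel (triangle_region 0 b c) = 1"
    unfolding measure_triangle_region[OF nc] using r2 s by (simp add: b_def c_def mult.assoc[symmetric])
  moreover have "angle_at 0 b c = \<theta>"
    using r \<theta> by (simp add: angle_at_def b_def c_def inner_complex_def norm_mult arccos_cos)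
  moreover have "dist 0 b = dist 0 c" by (simp add: b_def c_def norm_mult)
  ultimately have "triangle_region 0 b c \<in> isosceles_angle_triangles \<theta>"
    using nc unfolding isosceles_angle_triangles_def by blast
  then show ?thesis by blast
qed

text \<open>All isosceles competitors share the value \<open>Q0\<close>, every triangle of the class
  has \<open>Q0 \<le> Q\<close>, and both minima have denominators at least as large at
  \<open>Q\<close> as at \<open>Q0\<close>.\<close>

lemma rho_le_isosceles:
  assumes \<theta>: "0 < \<theta>" "\<theta> < pi" and S: "S \<in> angle_triangles \<theta>" and T: "T \<in> isosceles_angle_triangles \<theta>"
  shows "rho 1 S \<le> rho 1 T" "rho 2 S \<le> rho 2 T"
proof -
  define k i where "k = 2 / sin \<theta>" and "i = 2 / sin \<theta> * cos \<theta>"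
  have s: "0 < sin \<theta>" using \<theta> by (rule sin_gt_zero)
  have k: "0 < k" using s by (simp add: k_def)
  have ki: "k\<^sup>2 = i\<^sup>2 + 4"
    using s by (simp add: k_def i_def power_divide power_mult_distrib cos_squared_eq field_simps)
  define f where "f Q = Q + 48 * (k\<^sup>2 * (Q / 2 - i)) / (3 * Q\<^sup>2 - 16)" for Q
  define Q0 where "Q0 = 4 * k - 2 * i"
  obtain Q where Q: "Q0 \<le> Q" "rho 1 S = 4 / 3 / Q" "rho 2 S = 4 / 3 / f Q"
  proof -
    from S obtain a b c where "\<not> collinear {a, b, c}" "S = triangle_region a b c"
      "measure lborel (triangle_region a b c) = 1" "angle_at a b c = \<theta>"
      by (auto simp: angle_triangles_def)
    with rho_angle_triangle[OF \<theta>, of a b c] show ?thesis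
      by (intro that[of "2 * ((norm (b - a))\<^sup>2 + (norm (c - a))\<^sup>2) - 2 * i"])
         (simp_all add: f_def k_def i_def Q0_def)
  qed
  have T': "rho 1 T = 4 / 3 / Q0" "rho 2 T = 4 / 3 / f Q0"
  proof -
    from T obtain a b c where *: "\<not> collinear {a, b, c}" "T = triangle_region a b c"
      "measure lborel (triangle_region a b c) = 1" "angle_at a b c = \<theta>" "dist a b = dist a c"
      by (auto simp: isosceles_angle_triangles_def)
    then have "norm (b - a) = norm (c - a)" by (simp add: dist_norm norm_minus_commute)
    then have "2 * ((norm (b - a))\<^sup>2 + (norm (c - a))\<^sup>2) - 2 * i = Q0"
      using rho_angle_triangle(3)[OF \<theta> *(1,3,4)] by (simp add: k_def i_def Q0_def)
    with rho_angle_triangle(1,2)[OF \<theta> *(1,3,4)] show "rho 1 T = 4 / 3 / Q0" "rho 2 T = 4 / 3 / f Q0"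
      by (simp_all add: f_def k_def i_def *(2))
  qed
  have "\<bar>i\<bar> < k" using k ki by (intro power2_less_imp_less[of "\<bar>i\<bar>" k]) auto
  then have Q0: "2 * k < Q0" "0 < Q0" "0 < Q0 / 2 - i" by (auto simp: Q0_def)
  then show "rho 1 S \<le> rho 1 T" unfolding Q(2) T'(1) using Q(1) by (intro divide_left_mono) auto
  \<comment> \<open>Since \<open>k^2 = i^2 + 4\<close>, this gives \<open>16 < Q0^2\<close>, so the
    inner denominator is positive.\<close>
  have "4 * k\<^sup>2 < Q0\<^sup>2"
    using power_strict_mono[of "2 * k" Q0 2] Q0 k by (simp add: power_mult_distrib)
  then have "0 < 3 * Q0\<^sup>2 - 16" using ki zero_le_power2[of i] by linarith
  then have "0 < f Q0" unfolding f_def using Q0 k by (intro add_pos_pos divide_pos_pos mult_pos_pos) auto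
  moreover have "f Q0 \<le> f Q" unfolding f_def using ki k Q0_def Q(1) by (rule rho_2_denominator_mono)
  ultimately show "rho 2 S \<le> rho 2 T" unfolding Q(3) T'(2) by (intro divide_left_mono) auto
qed

theorem theorem2p10:
  fixes \<theta> :: real
  assumes "0 < \<theta>" and "\<theta> < pi"
  shows "isosceles_angle_triangles \<theta> \<noteq> {} \<and>
         (\<forall>T \<in> isosceles_angle_triangles \<theta>.
            is_arg_max (rho 1) (\<lambda>S. S \<in> angle_triangles \<theta>) T \<and>
            is_arg_max (rho 2) (\<lambda>S. S \<in> angle_triangles \<theta>) T)"
proof (intro conjI ballI)
  show "isosceles_angle_triangles \<theta> \<noteq> {}"
    by (rule isosceles_angle_triangles_nonempty[OF assms])
  fix T assume T: "T \<in> isosceles_angle_triangles \<theta>"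
  then have "T \<in> angle_triangles \<theta>"
    by (auto simp: isosceles_angle_triangles_def angle_triangles_def)
  with rho_le_isosceles[OF assms _ T]
  show "is_arg_max (rho 1) (\<lambda>S. S \<in> angle_triangles \<theta>) T" "is_arg_max (rho 2) (\<lambda>S. S \<in> angle_triangles \<theta>) T"
    by (auto simp: is_arg_max_def not_less)
qed

end
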